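(* Let $P=\{a,b,c\}$ be the poset whose only strict relations are $a<c$ and $b<c$, and let $\mu$ be the Möbius function of $P^{*}$, the set of finite words over $P$ with the generalized subword order. Then for all integers $0\le i\le j$, the value $\mu(a^{i},c^{j})$ equals the coefficient of $X^{j-i}$ in $T_{i+j}(X)$, where $T_n(X)$ denotes the $n$-th Chebyshev polynomial of the first kind.
   Context: The generalized subword order on $P^{*}$ (all finite words over $P$, including the empty word): $p_1\cdots p_k\le q_1\cdots q_l$ iff there exist indices $1\le j_1<\dots<j_k\le l$ with $p_i\le q_{j_i}$ in $P$ for all $1\le i\le k$. For a letter $x$, $x^k$ is the word $x\cdots x$ of length $k$ ($x^0$ is the empty word). Chebyshev polynomials of the first kind: $T_0(X)=1$, $T_1(X)=X$, $T_{n+2}(X)=2X\,T_{n+1}(X)-T_n(X)$ for $n\ge0$. *)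

theory Defs
  imports "HOL-Library.Sublist" "HOL-Computational_Algebra.Polynomial"
begin

locale locally_finite_poset = ordering less_eq less
  for less_eq :: "'a \<Rightarrow> 'a \<Rightarrow> bool" and less :: "'a \<Rightarrow> 'a \<Rightarrow> bool" +
  assumes finite_interval: "finite {z. less_eq x z \<and> less_eq z y}"
begin

function moebius :: "'a \<Rightarrow> 'a \<Rightarrow> int" where
  "moebius x y =
    (if x = y then 1
     else if less_eq x y then - (\<Sum>z\<in>{z. less_eq x z \<and> less z y}. moebius x z)
     else 0)"
  by auto
termination
proof (relation "measure (\<lambda>(x, y). card {z. less_eq x z \<and> less_eq z y})")
  fix x y z
  assume "less_eq x y" and z: "z \<in> {z. less_eq x z \<and> less z y}"
  then have "{w. less_eq x w \<and> less_eq w z} \<subset> {w. less_eq x w \<and> less_eq w y}"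
    using trans antisym refl unfolding strict_iff_order mem_Collect_eq psubset_eq by blast
  then show "((x, z), (x, y)) \<in> measure (\<lambda>(x, y). card {z. less_eq x z \<and> less_eq z y})"
    using finite_interval by (auto intro: psubset_card_mono)
qed simp

declare moebius.simps [simp del]

end

definition subword_le :: "'a::order list \<Rightarrow> 'a list \<Rightarrow> bool" where
  "subword_le = list_emb (\<le>)"

definition subword_less :: "'a::order list \<Rightarrow> 'a list \<Rightarrow> bool" where
  "subword_less u v \<longleftrightarrow> subword_le u v \<and> u \<noteq> v"

lemma subword_le_iff_index:
  "subword_le p q \<longleftrightarrow>
    (\<exists>j. strict_mono_on {..<length p} j \<and>
         (\<forall>i<length p. j i < length q \<and> p ! i \<le> q ! j i))"
proof
  assume "subword_le p q"
  then have "list_emb (\<le>) p q" by (simp add: subword_le_def)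
  then show "\<exists>j. strict_mono_on {..<length p} j \<and>
         (\<forall>i<length p. j i < length q \<and> p ! i \<le> q ! j i)"
  proof (induction)
    case (list_emb_Nil ys)
    then show ?case by (auto simp: strict_mono_on_def)
  next
    case (list_emb_Cons xs ys y)
    then obtain j where j: "strict_mono_on {..<length xs} j"
      "\<forall>i<length xs. j i < length ys \<and> xs ! i \<le> ys ! j i" by blast
    show ?case
      by (rule exI[of _ "\<lambda>i. Suc (j i)"]) (use j in \<open>auto simp: strict_mono_on_def\<close>)
  next
    case (list_emb_Cons2 x y xs ys)
    then obtain j where j: "strict_mono_on {..<length xs} j"
      "\<forall>i<length xs. j i < length ys \<and> xs ! i \<le> ys ! j i" by blast
    show ?case
      by (rule exI[of _ "\<lambda>i. case i of 0 \<Rightarrow> 0 | Suc k \<Rightarrow> Suc (j k)"])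
        (use j list_emb_Cons2 in \<open>auto simp: strict_mono_on_def nth_Cons split: nat.split\<close>)
  qed
next
  assume "\<exists>j. strict_mono_on {..<length p} j \<and>
         (\<forall>i<length p. j i < length q \<and> p ! i \<le> q ! j i)"
  then obtain j where "strict_mono_on {..<length p} j"
    "\<forall>i<length p. j i < length q \<and> p ! i \<le> q ! j i" by blast
  then have "list_emb (\<le>) p q"
  proof (induction q arbitrary: p j)
    case Nil
    then show ?case by (cases p) auto
  next
    case (Cons y q)
    show ?case
    proof (cases p)
      case Nil
      then show ?thesis by simp
    next
      case p: (Cons x p')
      have pos: "0 < j (Suc i)" if "Suc i < length p" for i
        using strict_mono_onD[OF Cons.prems(1), of 0 "Suc i"] that p by auto
      show ?thesis
      proof (cases "j 0 = 0")
        case True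
        have "list_emb (\<le>) p' q"
        proof (rule Cons.IH)
          show "strict_mono_on {..<length p'} (\<lambda>i. j (Suc i) - 1)"
          proof (rule strict_mono_onI)
            fix r s assume "r \<in> {..<length p'}" "s \<in> {..<length p'}" "r < s"
            then have "j (Suc r) < j (Suc s)" "0 < j (Suc r)"
              using strict_mono_onD[OF Cons.prems(1), of "Suc r" "Suc s"] pos[of r] p by auto
            then show "j (Suc r) - 1 < j (Suc s) - 1" by simp
          qed
          show "\<forall>i<length p'. j (Suc i) - 1 < length q \<and> p' ! i \<le> q ! (j (Suc i) - 1)"
          proof (intro allI impI)
            fix i assume "i < length p'"
            then have "j (Suc i) < length (y # q)" "p ! Suc i \<le> (y # q) ! j (Suc i)" "0 < j (Suc i)"
              using Cons.prems(2) pos p by auto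
            then show "j (Suc i) - 1 < length q \<and> p' ! i \<le> q ! (j (Suc i) - 1)"
              using p by (cases "j (Suc i)") auto
          qed
        qed
        moreover have "x \<le> y" using Cons.prems(2) p True by fastforce
        ultimately show ?thesis using p by auto
      next
        case False
        have pos': "0 < j i" if "i < length p" for i
          using pos False that by (cases i) auto
        have "list_emb (\<le>) p q"
        proof (rule Cons.IH)
          show "strict_mono_on {..<length p} (\<lambda>i. j i - 1)"
          proof (rule strict_mono_onI)
            fix r s assume "r \<in> {..<length p}" "s \<in> {..<length p}" "r < s"
            then have "j r < j s" "0 < j r"
              using strict_mono_onD[OF Cons.prems(1), of r s] pos'[of r] by auto
            then show "j r - 1 < j s - 1" by simp
          qed
          show "\<forall>i<length p. j i - 1 < length q \<and> p ! i \<le> q ! (j i - 1)"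
          proof (intro allI impI)
            fix i assume "i < length p"
            then have "j i < length (y # q)" "p ! i \<le> (y # q) ! j i" "0 < j i"
              using Cons.prems(2) pos' by auto
            then show "j i - 1 < length q \<and> p ! i \<le> q ! (j i - 1)"
              by (cases "j i") auto
          qed
        qed
        then show ?thesis by (rule list_emb_Cons)
      qed
    qed
  qed
  then show "subword_le p q" by (simp add: subword_le_def)
qed

lemma subword_le_antisym:
  fixes u v :: "'a::order list"
  assumes "subword_le u v" "subword_le v u"
  shows "u = v"
proof -
  have "list_all2 (\<le>) u v" if "list_emb (\<le>) u v" "length u = length v" for u v :: "'a list"
    using that
  proof (induction)
    case (list_emb_Cons xs ys y)
    then show ?case using list_emb_length[of "(\<le>)" xs ys] by simp
  qed simp_all
  then have "list_all2 (\<le>) u v" "list_all2 (\<le>) v u"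
    using assms list_emb_length[of "(\<le>)" u v] list_emb_length[of "(\<le>)" v u]
    by (simp_all add: subword_le_def)
  then show ?thesis
    by (auto simp: list_all2_conv_all_nth intro!: nth_equalityI order_antisym)
qed

global_interpretation subword: locally_finite_poset
  "subword_le :: 'a::{order,finite} list \<Rightarrow> 'a list \<Rightarrow> bool" subword_less
  defines subword_moebius = subword.moebius
proof
  fix u v w :: "'a list"
  show "subword_le u u"
    by (simp add: subword_le_def list_emb_refl)
  show "subword_less u v \<longleftrightarrow> subword_le u v \<and> u \<noteq> v"
    by (simp add: subword_less_def)
  show "u = v" if "subword_le u v" "subword_le v u"
    using that by (rule subword_le_antisym)
  show "subword_le u w" if "subword_le u v" "subword_le v w"
    using that list_emb_trans[of u v w "(\<le>)"] by (auto simp: subword_le_def)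
  have "{z. subword_le u z \<and> subword_le z v} \<subseteq> {z. set z \<subseteq> UNIV \<and> length z \<le> length v}"
    by (auto simp: subword_le_def dest: list_emb_length)
  then show "finite {z. subword_le u z \<and> subword_le z v}"
    using finite_lists_length_le[of "UNIV :: 'a set"] by (rule finite_subset) simp
qed

datatype letter = La | Lb | Lc

instantiation letter :: order
begin

definition less_letter :: "letter \<Rightarrow> letter \<Rightarrow> bool" where
  "x < y \<longleftrightarrow> (x, y) \<in> {(La, Lc), (Lb, Lc)}"

definition less_eq_letter :: "letter \<Rightarrow> letter \<Rightarrow> bool" where
  "x \<le> y \<longleftrightarrow> x < y \<or> x = (y :: letter)"

instance
  by standard (auto simp: less_letter_def less_eq_letter_def)

end

instance letter :: finite
proof
  have "(UNIV :: letter set) = {La, Lb, Lc}"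
    using letter.exhaust by blast
  then show "finite (UNIV :: letter set)"
    by (metis finite.emptyI finite.insertI)
qed

fun chebyshev_T :: "nat \<Rightarrow> int poly" where
  "chebyshev_T 0 = 1"
| "chebyshev_T (Suc 0) = [:0, 1:]"
| "chebyshev_T (Suc (Suc n)) = 2 * [:0, 1:] * chebyshev_T (Suc n) - chebyshev_T n"

end

(* The map z \<mapsto> (-1)^m * N(|z|, j), where m is the number of letters a, b in z and N(n, j) is the
   coefficient of t^n in (1 + t) (2 + t)^(j-1) (with N(n, 0) = [n = 0]), has sum [u = c^j] over each
   interval [u, c^j], hence it equals z \<mapsto> \<mu>(z, c^j). To sum the signs (-1)^m over the words z \<ge> u
   of length n, read u greedily from the left; call the result S(u, n). The letters above a, and those
   above b, have total sign 0, so S(u, n) = 0 if u starts with a or b. Otherwise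
   S(c v, n + 1) + 2 S(c v, n) = S(v, n), which matches N(n+1, j+1) = 2 N(n+1, j) + N(n, j).
   The latter is also the Chebyshev recursion, up to the sign (-1)^i. *)
theory Submission
  imports Defs
begin

lemma (in locally_finite_poset) sum_moebius:
  assumes "less_eq x y"
  shows "(\<Sum>z | less_eq x z \<and> less_eq z y. moebius x z) = (if x = y then 1 else 0)"
proof (cases "x = y")
  case True
  then have "{z. less_eq x z \<and> less_eq z y} = {y}"
    using antisym refl by blast
  with True show ?thesis by (simp add: moebius.simps[of y y])
next
  case False
  have "{z. less_eq x z \<and> less_eq z y} = insert y {z. less_eq x z \<and> less z y}"
    using assms refl unfolding strict_iff_order by blast
  moreover have "finite {z. less_eq x z \<and> less z y}"
    by (rule finite_subset[OF _ finite_interval[of x y]]) (use strict_iff_order in blast)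
  ultimately have "(\<Sum>z | less_eq x z \<and> less_eq z y. moebius x z) =
      moebius x y + (\<Sum>z | less_eq x z \<and> less z y. moebius x z)"
    using strict_iff_order[of y y] by simp
  with False assms show ?thesis by (simp add: moebius.simps[of x y])
qed

text \<open>The recursion for \<open>moebius\<close> fixes the lower argument, while
  \<open>f\<close> solves the one with the upper argument fixed. A left and a right inverse agree:
  sum \<open>moebius x z * f w\<close> over x \<le> z \<le> w \<le> y in both orders.\<close>

lemma (in locally_finite_poset) moebius_eqI:
  assumes f: "\<And>u. less_eq u y \<Longrightarrow>
      (\<Sum>z | less_eq u z \<and> less_eq z y. f z) = (if u = y then 1 else 0)"
    and xy: "less_eq x y"
  shows "moebius x y = f x"
proof -
  let ?I = "\<lambda>x y. {z. less_eq x z \<and> less_eq z y}"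
  have "moebius x y = (\<Sum>z\<in>?I x y. if z = y then moebius x z else 0)"
    using xy refl finite_interval by (subst sum.delta) auto
  also have "\<dots> = (\<Sum>z\<in>?I x y. moebius x z * (\<Sum>w\<in>?I z y. f w))"
    using f by (intro sum.cong) auto
  also have "\<dots> = (\<Sum>z\<in>?I x y. \<Sum>w | w \<in> ?I x y \<and> less_eq z w. moebius x z * f w)"
    unfolding sum_distrib_left by (intro sum.cong) (auto intro: trans)
  also have "\<dots> = (\<Sum>w\<in>?I x y. \<Sum>z | z \<in> ?I x y \<and> less_eq z w. moebius x z * f w)"
    by (rule sum.swap_restrict[OF finite_interval finite_interval])
  also have "\<dots> = (\<Sum>w\<in>?I x y. (\<Sum>z\<in>?I x w. moebius x z) * f w)"
    unfolding sum_distrib_right by (intro sum.cong) (auto intro: trans)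
  also have "\<dots> = (\<Sum>w\<in>?I x y. if w = x then f w else 0)"
    using sum_moebius by (intro sum.cong) auto
  also have "\<dots> = f x"
    using xy refl finite_interval by (subst sum.delta) auto
  finally show ?thesis .
qed

lemma subword_le_Nil [simp]: "subword_le [] z"
  by (simp add: subword_le_def)

lemma not_subword_le_Nil [simp]: "\<not> subword_le (x # u) []"
  by (simp add: subword_le_def)

text \<open>Greedy matching loses nothing: if \<open>x # u\<close> embeds into \<open>z\<close>, so
  does \<open>u\<close>, hence \<open>x\<close> may be matched with the first letter above
  it.\<close>

lemma subword_le_Cons_Cons:
  "subword_le (x # u) (y # z) \<longleftrightarrow> (if x \<le> y then subword_le u z else subword_le (x # u) z)"
  by (auto simp: subword_le_def elim: list_emb.cases dest: list_emb_ConsD)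

lemma subword_le_replicate_Lc: "subword_le z (replicate j Lc) \<longleftrightarrow> length z \<le> j"
proof (induction z arbitrary: j)
  case (Cons x z)
  have "x \<le> Lc" by (cases x) (auto simp: less_eq_letter_def less_letter_def)
  with Cons show ?case by (cases j) (simp_all add: subword_le_Cons_Cons)
qed simp

definition letter_sign :: "letter \<Rightarrow> int" where
  "letter_sign x = (if x = Lc then 1 else - 1)"

definition word_sign :: "letter list \<Rightarrow> int" where
  "word_sign z = prod_list (map letter_sign z)"

definition sign_sum :: "letter list \<Rightarrow> nat \<Rightarrow> int" where
  "sign_sum u n = (\<Sum>z | length z = n \<and> subword_le u z. word_sign z)"

lemma finite_words: "finite {z :: 'a::finite list. length z = n \<and> P z}"
  by (rule finite_subset[OF _ finite_lists_length_eq[of UNIV n]]) auto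

lemma sign_sum_Nil_0: "sign_sum [] 0 = 1"
proof -
  have "{z :: letter list. length z = 0 \<and> subword_le [] z} = {[]}" by auto
  then show ?thesis by (simp add: sign_sum_def word_sign_def)
qed

lemma sign_sum_Cons_0: "sign_sum (x # u) 0 = 0"
  by (auto simp: sign_sum_def intro: sum.neutral)

lemma sign_sum_Suc:
  "sign_sum u (Suc n) =
    (\<Sum>y\<in>{La, Lb, Lc}. letter_sign y * (\<Sum>z | length z = n \<and> subword_le u (y # z). word_sign z))"
proof -
  let ?A = "\<lambda>y. {z. length z = n \<and> subword_le u (y # z)}"
  have "{z. length z = Suc n \<and> subword_le u z} = (\<Union>y\<in>{La, Lb, Lc}. (#) y ` ?A y)"
  proof (intro subset_antisym subsetI)
    fix z assume z: "z \<in> {z. length z = Suc n \<and> subword_le u z}"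
    then obtain y w where "z = y # w" by (cases z) auto
    with z show "z \<in> (\<Union>y\<in>{La, Lb, Lc}. (#) y ` ?A y)" by (cases y) auto
  qed auto
  then have "sign_sum u (Suc n) = (\<Sum>y\<in>{La, Lb, Lc}. \<Sum>z\<in>(#) y ` ?A y. word_sign z)"
    unfolding sign_sum_def by (subst sum.UNION_disjoint[symmetric]) (auto simp: finite_words)
  also have "\<dots> = (\<Sum>y\<in>{La, Lb, Lc}. letter_sign y * (\<Sum>z\<in>?A y. word_sign z))"
    by (intro sum.cong refl) (simp add: sum.reindex word_sign_def sum_distrib_left)
  finally show ?thesis .
qed

lemma sign_sum_Nil_Suc: "sign_sum [] (Suc n) = - sign_sum [] n"
  by (simp add: sign_sum_Suc letter_sign_def) (simp add: sign_sum_def)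

text \<open>A first letter c is matched with the leading \<open>Lc\<close>; a first letter a or b
  has to be skipped, each with sign -1.\<close>

lemma sign_sum_Lc_Suc: "sign_sum (Lc # u) (Suc n) = sign_sum u n - 2 * sign_sum (Lc # u) n"
  by (simp add: sign_sum_Suc letter_sign_def subword_le_Cons_Cons less_eq_letter_def less_letter_def)
    (simp add: sign_sum_def)

text \<open>As first letters, c and \<open>x\<close> itself both match and cancel by sign; the third
  letter is skipped with sign -1. The sums thus only change sign, starting from 0.\<close>

lemma sign_sum_Cons_eq_0:
  assumes "x \<noteq> Lc"
  shows "sign_sum (x # u) n = 0"
proof (induction n)
  case (Suc n)
  have "sign_sum (x # u) (Suc n) = - sign_sum (x # u) n"
    using assms
    by (cases x; simp add: sign_sum_Suc letter_sign_def subword_le_Cons_Cons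
        less_eq_letter_def less_letter_def; simp add: sign_sum_def)
  with Suc show ?case by simp
qed (rule sign_sum_Cons_0)

text \<open>This is N(n, j): raising j by one multiplies the generating polynomial in t by 2 + t,
  except that the first factor is 1 + t.\<close>

fun embed_weight :: "nat \<Rightarrow> nat \<Rightarrow> int" where
  "embed_weight 0 0 = 1"
| "embed_weight (Suc n) 0 = 0"
| "embed_weight 0 (Suc j) = 2 ^ j"
| "embed_weight (Suc n) (Suc j) = 2 * embed_weight (Suc n) j + embed_weight n j"

lemma embed_weight_eq_0: "j < n \<Longrightarrow> embed_weight n j = 0"
  by (induction n j rule: embed_weight.induct) auto

(* The correction term is there because embed_weight 0 1 = 1 is not twice embed_weight 0 0. *)
lemma sum_embed_weight_Suc:
  "(\<Sum>n\<le>Suc j. embed_weight n (Suc j) * s n) =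
    (\<Sum>n\<le>j. embed_weight n j * (2 * s n + s (Suc n))) - (if j = 0 then s 0 else 0)"
proof -
  \<comment> \<open>The shifted sum ends at index j + 1, where the weight vanishes.\<close>
  have shift: "(\<Sum>n\<le>j. embed_weight (Suc n) j * s (Suc n)) =
      (\<Sum>n\<le>j. embed_weight n j * s n) - embed_weight 0 j * s 0"
    using sum.atMost_Suc_shift[of "\<lambda>n. embed_weight n j * s n" j] by (simp add: embed_weight_eq_0)
  have "(\<Sum>n\<le>Suc j. embed_weight n (Suc j) * s n) = embed_weight 0 (Suc j) * s 0 +
      2 * (\<Sum>n\<le>j. embed_weight (Suc n) j * s (Suc n)) + (\<Sum>n\<le>j. embed_weight n j * s (Suc n))"
    by (subst sum.atMost_Suc_shift) (simp add: algebra_simps sum.distrib sum_distrib_left)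
  also have "\<dots> = (\<Sum>n\<le>j. embed_weight n j * (2 * s n + s (Suc n))) +
      (embed_weight 0 (Suc j) - 2 * embed_weight 0 j) * s 0"
    unfolding shift by (simp add: algebra_simps sum.distrib sum_distrib_left)
  also have "embed_weight 0 (Suc j) - 2 * embed_weight 0 j = (if j = 0 then - 1 else 0)"
    by (cases j) simp_all
  finally show ?thesis by simp
qed

lemma sum_embed_weight_sign_sum:
  "(\<Sum>n\<le>j. embed_weight n j * sign_sum u n) = (if u = replicate j Lc then 1 else 0)"
proof (induction u arbitrary: j)
  case Nil
  show ?case
  proof (induction j)
    case (Suc j)
    \<comment> \<open>Here 2 s(n) + s(n+1) = s(n), so the value for j carries over to j + 1; the
      correction removes the initial 1 at j = 0.\<close>
    then show ?case
      by (simp only: sum_embed_weight_Suc) (auto simp: sign_sum_Nil_Suc sign_sum_Nil_0)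
  qed (simp add: sign_sum_Nil_0)
next
  case (Cons x u)
  show ?case
  proof (cases "x = Lc")
    case True
    show ?thesis
    proof (cases j)
      case (Suc k)
      \<comment> \<open>Now 2 s(n) + s(n+1) is \<open>sign_sum u n\<close>, and s(0) = 0 kills the
        correction: one c is dropped from both words.\<close>
      have "(\<Sum>n\<le>j. embed_weight n j * sign_sum (x # u) n) =
          (\<Sum>n\<le>k. embed_weight n k * sign_sum u n)"
        unfolding Suc sum_embed_weight_Suc True by (simp add: sign_sum_Lc_Suc sign_sum_Cons_0)
      with Cons Suc True show ?thesis by simp
    qed (simp add: sign_sum_Cons_0)
  next
    case False
    then show ?thesis by (cases j) (simp_all add: sign_sum_Cons_eq_0)
  qed
qed

lemma subword_moebius_replicate_Lc:
  assumes "length u \<le> j"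
  shows "subword_moebius u (replicate j Lc) = word_sign u * embed_weight (length u) j"
proof (rule subword.moebius_eqI)
  let ?y = "replicate j Lc"
  fix u
  let ?f = "\<lambda>z. word_sign z * embed_weight (length z) j"
  let ?I = "{z. subword_le u z \<and> subword_le z ?y}"
  \<comment> \<open>Membership below c^j depends only on the length, so the words are grouped by
    length.\<close>
  have "(\<Sum>z\<in>?I. ?f z) = (\<Sum>n\<le>j. \<Sum>z | z \<in> ?I \<and> length z = n. ?f z)"
    using subword.finite_interval[of u ?y]
    by (intro sum.group[symmetric]) (auto simp: subword_le_replicate_Lc)
  also have "\<dots> = (\<Sum>n\<le>j. embed_weight n j * sign_sum u n)"
    unfolding sign_sum_def sum_distrib_left
    by (intro sum.cong) (auto simp: subword_le_replicate_Lc)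
  finally show "(\<Sum>z\<in>?I. ?f z) = (if u = ?y then 1 else 0)"
    by (simp add: sum_embed_weight_sign_sum)
qed (use assms in \<open>simp add: subword_le_replicate_Lc\<close>)

lemma coeff_2X_mult: "coeff (2 * [:0, 1:] * p) n = (case n of 0 \<Rightarrow> 0 | Suc m \<Rightarrow> 2 * coeff p m)"
  for p :: "int poly"
proof -
  have "2 * [:0, 1:] * p = pCons 0 (smult 2 p)" by (simp add: numeral_poly)
  then show ?thesis by (simp add: coeff_pCons split: nat.split)
qed

lemma coeff_chebyshev_T_eq_0: "n < k \<Longrightarrow> coeff (chebyshev_T n) k = 0"
  by (induction n arbitrary: k rule: chebyshev_T.induct)
    (auto simp: coeff_2X_mult coeff_pCons split: nat.split simp del: mult_pCons_right)

lemma coeff_chebyshev_T_lead: "coeff (chebyshev_T (Suc n)) (Suc n) = 2 ^ n"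
  by (induction n)
    (simp_all only: chebyshev_T.simps coeff_diff coeff_2X_mult, simp_all add: coeff_chebyshev_T_eq_0)

text \<open>For i = 0 this is the leading coefficient. Otherwise the two terms of the Chebyshev
  recursion for (i+1, j+1) belong to the index pairs (i+1, j) and (i, j), as in the recursion for
  \<open>embed_weight\<close>.\<close>

lemma coeff_chebyshev_T:
  "i \<le> j \<Longrightarrow> coeff (chebyshev_T (i + j)) (j - i) = (- 1) ^ i * embed_weight i j"
proof (induction i j rule: embed_weight.induct)
  case (3 j)
  then show ?case by (simp add: coeff_chebyshev_T_lead del: chebyshev_T.simps)
next
  case (4 i j)
  have IH: "coeff (chebyshev_T (i + j)) (j - i) = (- 1) ^ i * embed_weight i j"
    using 4 by simp
  have "coeff (chebyshev_T (Suc i + Suc j)) (Suc j - Suc i) =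
      (case j - i of 0 \<Rightarrow> 0 | Suc m \<Rightarrow> 2 * coeff (chebyshev_T (Suc i + j)) m)
      - coeff (chebyshev_T (i + j)) (j - i)"
    by (simp only: add_Suc add_Suc_right chebyshev_T.simps coeff_diff coeff_2X_mult diff_Suc_Suc)
  \<comment> \<open>For j = i the induction hypothesis at (i+1, j) is out of range, but both sides
    are 0.\<close>
  also have "(case j - i of 0 \<Rightarrow> 0 | Suc m \<Rightarrow> 2 * coeff (chebyshev_T (Suc i + j)) m) =
      2 * ((- 1) ^ Suc i * embed_weight (Suc i) j)"
  proof (cases "j - i")
    case 0
    then show ?thesis by (simp add: embed_weight_eq_0)
  next
    case (Suc m)
    then have "m = j - Suc i" "Suc i \<le> j" by auto
    with 4 Suc show ?thesis by simp
  qed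
  finally show ?case using IH by (simp add: algebra_simps)
qed auto

theorem corollary1:
  fixes i j :: nat
  assumes "i \<le> j"
  shows "subword_moebius (replicate i La) (replicate j Lc) = coeff (chebyshev_T (i + j)) (j - i)"
  using assms
  by (simp add: subword_moebius_replicate_Lc coeff_chebyshev_T word_sign_def letter_sign_def)

end
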